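(* Let $n\ge3$, $m\ge3$ be integers with $(n,m)\ne(3,4)$, let $\mathbf w_1,\dots,\mathbf w_n\in\mathbb R^{n-1}$ be a regular simplex frame, and let $\mathcal S=\sum_{i=1}^n\mathbf w_i^{\circ m}$ be the associated regular simplex tensor. Then every vector $\mathbf w_1,\dots,\mathbf w_n$ of the frame is a local maximum solution of the problem of maximizing $\mathcal S\mathbf v^m$ over $\mathbf v\in\mathbb R^{n-1}$ subject to $\mathbf v^{\mathrm T}\mathbf v=1$.
   Context: A regular simplex frame is a collection of $n$ vectors $\mathbf w_1,\dots,\mathbf w_n\in\mathbb R^{n-1}$ with $\|\mathbf w_i\|=1$ for all $i$, $\langle\mathbf w_i,\mathbf w_j\rangle=-\frac1{n-1}$ for all $i\ne j$, and $\mathbf W\mathbf W^{\mathrm T}=\frac{n}{n-1}\mathbf I_{n-1}$, where $\mathbf W=(\mathbf w_1,\dots,\mathbf w_n)$. The tensor $\mathbf w^{\circ m}$ is the $m$-fold outer product of $\mathbf w$ with itself, so that $\mathcal S\mathbf v^m=\sum_{i_1,\dots,i_m}s_{i_1,\dots,i_m}v_{i_1}\cdots v_{i_m}=\sum_{i=1}^n(\mathbf w_i^{\mathrm T}\mathbf v)^m$. Local maximality is relative to the unit sphere of $\mathbb R^{n-1}$. *)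

theory Defs
  imports "HOL-Analysis.Analysis"
begin

text \<open>The matrix whose columns are the vectors \<open>w i\<close>.\<close>

definition frame_matrix :: "('i::finite \<Rightarrow> real ^ 'd::finite) \<Rightarrow> real ^ 'i ^ 'd" where
  "frame_matrix w = (\<chi> a i. w i $ a)"

text \<open>A family of \<open>n = CARD('i)\<close> vectors in the space of dimension \<open>n - 1 = CARD('d)\<close>.
  Since \<open>CARD('d) > 0\<close>, the subtraction on \<open>nat\<close> forces \<open>n \<ge> 2\<close>.\<close>

definition regular_simplex_frame :: "('i::finite \<Rightarrow> real ^ 'd::finite) \<Rightarrow> bool" where
  "regular_simplex_frame w \<longleftrightarrow>
     CARD('d) = CARD('i) - 1 \<and>
     (\<forall>i. norm (w i) = 1) \<and>
     (\<forall>i j. i \<noteq> j \<longrightarrow> w i \<bullet> w j = - 1 / (real CARD('i) - 1)) \<and>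
     frame_matrix w ** transpose (frame_matrix w)
       = (real CARD('i) / (real CARD('i) - 1)) *\<^sub>R mat 1"

text \<open>A tensor of order \<open>m\<close> over \<open>real ^ 'd\<close> is represented by its array of entries, a function
  on multi-indices; a multi-index is a list of length \<open>m\<close> over \<open>'d\<close>, and entries at lists of
  any other length are set to 0.\<close>

type_synonym 'd tensor = "'d list \<Rightarrow> real"

definition outer_power :: "nat \<Rightarrow> real ^ 'd::finite \<Rightarrow> 'd tensor" where
  "outer_power m w = (\<lambda>is. if length is = m then \<Prod>k<m. w $ (is ! k) else 0)"

definition simplex_tensor :: "nat \<Rightarrow> ('i::finite \<Rightarrow> real ^ 'd::finite) \<Rightarrow> 'd tensor" where
  "simplex_tensor m w = (\<lambda>is. \<Sum>i\<in>UNIV. outer_power m (w i) is)"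

definition tensor_form :: "nat \<Rightarrow> 'd tensor \<Rightarrow> real ^ 'd::finite \<Rightarrow> real" where
  "tensor_form m S v = (\<Sum>is | length is = m. S is * (\<Prod>k<m. v $ (is ! k)))"

definition local_max_on :: "('a::metric_space \<Rightarrow> real) \<Rightarrow> 'a set \<Rightarrow> 'a \<Rightarrow> bool" where
  "local_max_on f A x \<longleftrightarrow> x \<in> A \<and> (\<exists>e>0. \<forall>y\<in>A. dist y x < e \<longrightarrow> f y \<le> f x)"

end

theory Submission imports Defs begin

text \<open>Write \<open>N = n - 1\<close> and \<open>c = - 1 / N\<close>. The form of the tensor is the power sum of the
  coordinates \<open>w j \<bullet> v\<close>; at \<open>v = w i\<close> the coordinate with index \<open>i\<close> equals 1 and all others
  equal \<open>c\<close>. The frame conditions fix the first two moments of these coordinates for every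
  unit vector \<open>v\<close>: they sum to 0, and their squares sum to \<open>1 + 1 / N\<close>
  (\<open>sum_regular_simplex_frame\<close>, \<open>sum_inner_sq_regular_simplex_frame\<close>). Consequently the
  deviations from the values at \<open>w i\<close> are controlled by the single number
  \<open>d = 1 - w i \<bullet> v \<ge> 0\<close>: over \<open>j \<noteq> i\<close>, the deviations \<open>w j \<bullet> v - c\<close> sum to \<open>d\<close> and their
  squares sum to at most \<open>2 * (1 + 1 / N) * d\<close>.

  Bounding each power near its base value by its tangent line plus a quadratic term
  (\<open>eventually_power_le_quadratic\<close>) turns the claim into a statement about the coefficient
  of \<open>d\<close>. The coordinate \<open>i\<close> loses \<open>m * d\<close> up to a multiple of \<open>d\<^sup>2\<close>; the others gain at most
  \<open>m * c ^ (m - 1) * d\<close> from the tangent lines and, with \<open>K\<close> slightly above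
  \<open>(m choose 2) * c ^ (m - 2)\<close>, at most \<open>2 * K * (1 + 1 / N) * d\<close> from the quadratic terms. The
  loss wins because
  \<open>(m - 1) * c ^ (m - 2) * (1 + 1 / N) < 1 - c ^ (m - 1)\<close>
  (\<open>simplex_second_order_condition\<close>). For odd \<open>m\<close> the left-hand side is negative; for even \<open>m\<close>
  the inequality says \<open>(m - 1) * (N + 1) < N ^ (m - 1) + 1\<close>, which for \<open>N \<ge> 2\<close> and
  \<open>m \<ge> 3\<close> fails, with equality, exactly in the case \<open>N = 2\<close>, \<open>m = 4\<close>. There the form is constant on the circle, so the
  second-order test must degenerate.\<close>

section \<open>The form of the simplex tensor as a power sum\<close>

text \<open>The multinomial expansion without collecting equal terms: a multi-index records the
  summand chosen from each of the \<open>m\<close> factors.\<close>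

lemma sum_lists_prod_nth:
  fixes f :: "'d::finite \<Rightarrow> real"
  shows "(\<Sum>is | length is = m. \<Prod>k<m. f (is ! k)) = (\<Sum>a\<in>UNIV. f a) ^ m"
proof (induction m)
  case 0
  show ?case by simp
next
  case (Suc m)
  have lists: "{is :: 'd list. length is = Suc m}
      = (\<lambda>(a, is). a # is) ` (UNIV \<times> {is. length is = m})"
    by (auto simp: length_Suc_conv image_iff)
  have "(\<Sum>is | length is = Suc m. \<Prod>k<Suc m. f (is ! k))
      = (\<Sum>(a, is)\<in>UNIV \<times> {is. length is = m}. f a * (\<Prod>k<m. f (is ! k)))"
    unfolding lists
    by (subst sum.reindex)
       (auto simp: inj_on_def prod.lessThan_Suc_shift case_prod_beta o_def
             simp del: prod.lessThan_Suc intro!: sum.cong)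
  also have "\<dots> = (\<Sum>a\<in>UNIV. f a) * (\<Sum>is | length is = m. \<Prod>k<m. f (is ! k))"
    by (simp add: sum_product sum.cartesian_product)
  finally show ?case using Suc.IH by simp
qed

lemma tensor_form_simplex_tensor:
  "tensor_form m (simplex_tensor m w) v = (\<Sum>j\<in>UNIV. (w j \<bullet> v) ^ m)"
proof -
  have "tensor_form m (simplex_tensor m w) v
      = (\<Sum>is | length is = m. \<Sum>j\<in>UNIV. \<Prod>k<m. w j $ (is ! k) * v $ (is ! k))"
    unfolding tensor_form_def simplex_tensor_def outer_power_def
    by (intro sum.cong) (simp_all add: sum_distrib_right prod.distrib)
  also have "\<dots> = (\<Sum>j\<in>UNIV. \<Sum>is | length is = m. \<Prod>k<m. w j $ (is ! k) * v $ (is ! k))"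
    by (rule sum.swap)
  also have "\<dots> = (\<Sum>j\<in>UNIV. (w j \<bullet> v) ^ m)"
    using sum_lists_prod_nth[where m = m and f = "\<lambda>a. w j $ a * v $ a" for j]
    by (simp add: inner_vec_def)
  finally show ?thesis .
qed

section \<open>Moments of a regular simplex frame\<close>

text \<open>Each row of the Gram matrix sums to 0, so the sum of the frame has norm 0.\<close>

lemma sum_regular_simplex_frame:
  fixes w :: "'i::finite \<Rightarrow> real ^ 'd::finite"
  assumes "regular_simplex_frame w"
  shows "(\<Sum>j\<in>UNIV. w j) = 0"
proof -
  have "CARD('i) - 1 > 0"
    using assms unfolding regular_simplex_frame_def by (metis zero_less_card_finite)
  then have n: "real CARD('i) > 1" by simp
  have inner: "w i \<bullet> w j = (if j = i then 1 else - 1 / (real CARD('i) - 1))" for i j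
    using assms by (auto simp: regular_simplex_frame_def dot_square_norm)
  have row: "(\<Sum>j\<in>UNIV. w i \<bullet> w j) = 0" for i
  proof -
    have "(\<Sum>j\<in>UNIV. w i \<bullet> w j) = 1 + (\<Sum>j\<in>UNIV - {i}. - 1 / (real CARD('i) - 1))"
      by (subst sum.remove[of _ i]) (auto simp: inner intro!: sum.cong)
    also have "\<dots> = 0"
      using n by (simp add: of_nat_diff)
    finally show ?thesis .
  qed
  have "(\<Sum>j\<in>UNIV. w j) \<bullet> (\<Sum>j\<in>UNIV. w j) = 0"
    by (simp add: inner_sum_left inner_sum_right[of "w _"] row)
  then show ?thesis by simp
qed

text \<open>The left-hand side is the squared norm of \<open>transpose W *v v\<close>, hence the quadratic form of
  \<open>W ** transpose W\<close>, which the frame condition makes a multiple of the identity.\<close>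

lemma sum_inner_sq_regular_simplex_frame:
  fixes w :: "'i::finite \<Rightarrow> real ^ 'd::finite"
  assumes "regular_simplex_frame w"
  shows "(\<Sum>j\<in>UNIV. (w j \<bullet> v)\<^sup>2) = real CARD('i) / (real CARD('i) - 1) * (v \<bullet> v)"
proof -
  let ?W = "frame_matrix w"
  have coeff: "(transpose ?W *v v) $ j = w j \<bullet> v" for j
    by (simp add: frame_matrix_def transpose_def matrix_vector_mult_def inner_vec_def)
  have "(\<Sum>j\<in>UNIV. (w j \<bullet> v)\<^sup>2) = (transpose ?W *v v) \<bullet> (transpose ?W *v v)"
    by (simp add: inner_vec_def[of "transpose ?W *v v"] coeff power2_eq_square del: transpose_matrix_vector)
  also have "\<dots> = v \<bullet> ((?W ** transpose ?W) *v v)"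
    by (metis dot_lmul_matrix matrix_vector_mul_assoc transpose_matrix_vector)
  also have "\<dots> = real CARD('i) / (real CARD('i) - 1) * (v \<bullet> v)"
    using assms by (simp add: regular_simplex_frame_def flip: scaleR_matrix_vector_assoc)
  finally show ?thesis .
qed

section \<open>A local quadratic majorant of a power\<close>

text \<open>Taylor expansion with a continuous second-order coefficient. Multiplying the expansion of
  \<open>x ^ m\<close> by \<open>x = c + (x - c)\<close> gives that of \<open>x ^ Suc m\<close>, so induction replaces
  derivatives.\<close>

lemma power_expansion_order_two:
  fixes c :: real
  shows "\<exists>r. isCont r c \<and> r c = real (m choose 2) * c ^ (m - 2) \<and>
    (\<forall>x. x ^ m = c ^ m + real m * c ^ (m - 1) * (x - c) + r x * (x - c)\<^sup>2)"
proof (induction m)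
  case 0
  show ?case by (intro exI[of _ "\<lambda>x. 0"]) simp
next
  case (Suc m)
  then obtain r where r: "isCont r c" "r c = real (m choose 2) * c ^ (m - 2)"
    "\<And>x. x ^ m = c ^ m + real m * c ^ (m - 1) * (x - c) + r x * (x - c)\<^sup>2"
    by blast
  \<comment> \<open>The truncated exponents are harmless: whenever one truncates, the factor in front is 0.\<close>
  have m1: "real m * c ^ m = real m * (c ^ (m - 1) * c)"
    by (cases m) simp_all
  have m2: "real (m choose 2) * c ^ (m - 1) = real (m choose 2) * (c ^ (m - 2) * c)"
  proof (cases "m < 2")
    case False
    then obtain k where "m = Suc (Suc k)"
      by (metis add_2_eq_Suc le_Suc_ex not_less)
    then show ?thesis by simp
  qed simp
  let ?r = "\<lambda>x. real m * c ^ (m - 1) + x * r x"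
  have "isCont ?r c" using r(1) by (intro continuous_intros)
  moreover have "?r c = real (Suc m choose 2) * c ^ (Suc m - 2)"
  proof -
    have "?r c = real m * c ^ (m - 1) + real (m choose 2) * c ^ (m - 1)"
      unfolding m2 r(2) by (simp only: mult_ac)
    then show ?thesis by (simp add: numeral_2_eq_2 distrib_right)
  qed
  moreover have "x ^ Suc m = c ^ Suc m + real (Suc m) * c ^ (Suc m - 1) * (x - c)
      + ?r x * (x - c)\<^sup>2" for x
  proof -
    have "x ^ Suc m = x * (c ^ m + real m * c ^ (m - 1) * (x - c) + r x * (x - c)\<^sup>2)"
      using r(3)[of x] by simp
    also have "\<dots> = c ^ Suc m + c ^ m * (x - c) + real m * (c ^ (m - 1) * c) * (x - c)
        + ?r x * (x - c)\<^sup>2"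
      by (simp add: algebra_simps power2_eq_square)
    also have "\<dots> = c ^ Suc m + c ^ m * (x - c) + real m * c ^ m * (x - c) + ?r x * (x - c)\<^sup>2"
      by (simp only: m1)
    finally show ?thesis by (simp add: algebra_simps)
  qed
  ultimately show ?case by blast
qed

lemma eventually_power_le_quadratic:
  fixes c K :: real
  assumes "K > real (m choose 2) * c ^ (m - 2)"
  shows "\<forall>\<^sub>F x in nhds c. x ^ m \<le> c ^ m + real m * c ^ (m - 1) * (x - c) + K * (x - c)\<^sup>2"
proof -
  obtain r where r: "isCont r c" "r c = real (m choose 2) * c ^ (m - 2)"
    "\<And>x. x ^ m = c ^ m + real m * c ^ (m - 1) * (x - c) + r x * (x - c)\<^sup>2"
    using power_expansion_order_two by blast
  have "(r \<longlongrightarrow> r c) (nhds c)" using r(1) by (simp add: isCont_def tendsto_at_iff_tendsto_nhds)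
  then have "\<forall>\<^sub>F x in nhds c. r x < K"
    using assms r(2) by (simp add: order_tendstoD)
  then show ?thesis
  proof (rule eventually_mono)
    fix x assume "r x < K"
    then have "r x * (x - c)\<^sup>2 \<le> K * (x - c)\<^sup>2" by (intro mult_right_mono) auto
    then show "x ^ m \<le> c ^ m + real m * c ^ (m - 1) * (x - c) + K * (x - c)\<^sup>2"
      using r(3)[of x] by linarith
  qed
qed

section \<open>The second-order condition at a frame vector\<close>

text \<open>The excluded pair is the case of equality \<open>9 = 9\<close>, so for \<open>N = 2\<close> the induction on \<open>k\<close>
  starts at 4 instead of 3.\<close>

lemma mult_add_one_less_power_add_one:
  fixes N k :: nat
  assumes "N \<ge> 2" "k \<ge> 3" "(N, k) \<noteq> (2, 3)"
  shows "k * (N + 1) < N ^ k + 1"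
proof -
  have incr: "Suc k * (N + 1) < N ^ Suc k + 1" if "k * (N + 1) < N ^ k + 1" "k \<ge> 3" for k
  proof -
    have "N + 1 \<le> k * (N + 1)" using that mult_le_mono1[of 1 k "N + 1"] by simp
    then have "N + 1 \<le> N ^ k" using that by linarith
    moreover have "2 * N ^ k \<le> N * N ^ k" using assms by simp
    ultimately have "k * (N + 1) + (N + 1) < N * N ^ k + 1" using that by linarith
    then show ?thesis by simp
  qed
  show ?thesis
  proof (cases "N = 2")
    case True
    with assms have "k \<ge> 4" by (auto simp: le_less)
    then show ?thesis
    proof (induction k rule: dec_induct)
      case base
      then show ?case using True by simp
    next
      case (step k)
      then show ?case using incr by simp
    qed
  next
    case False
    with assms have N: "N \<ge> 3" by simp
    from \<open>k \<ge> 3\<close> show ?thesis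
    proof (induction k rule: dec_induct)
      case base
      have "3 * 3 * N \<le> N * N * N" using N by (intro mult_mono) auto
      then have "9 * N \<le> N ^ 3" by (simp add: power3_eq_cube)
      moreover have "3 * (N + 1) < 9 * N + 1" using N by simp
      ultimately show ?case by (meson add_le_mono1 less_le_trans)
    next
      case (step k)
      then show ?case using incr by simp
    qed
  qed
qed

text \<open>Up to a factor \<open>m\<close>, the left-hand side is the rate in \<open>d\<close> at which the quadratic terms can
  gain, and the right-hand side is the net rate of loss from the linear terms.\<close>

lemma simplex_second_order_condition:
  fixes N m :: nat and c :: real
  assumes "N \<ge> 2" "m \<ge> 3" "(N, m) \<noteq> (2, 4)" and c: "c = - 1 / real N"
  shows "real (m - 1) * c ^ (m - 2) * (1 + 1 / real N) < 1 - c ^ (m - 1)"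
proof -
  define k where "k = m - 2"
  have m: "m - 1 = Suc k" "m - 2 = k" "m = k + 2" "k \<ge> 1" using assms by (auto simp: k_def)
  have N: "real N > 0" using assms by simp
  show ?thesis
  proof (cases "even m")
    case True
    then have "even k" using m by simp
    then have ck: "c ^ k = 1 / real N ^ k" "c ^ Suc k = - 1 / real N ^ Suc k"
      by (simp_all add: c power_divide)
    have "k \<noteq> 1" using \<open>even k\<close> by auto
    then have "Suc k * (N + 1) < N ^ Suc k + 1"
      using assms m by (intro mult_add_one_less_power_add_one) auto
    then have "real (Suc k * (N + 1)) < real (N ^ Suc k + 1)"
      by (rule iffD2[OF of_nat_less_iff])
    then have "real (Suc k) * (real N + 1) < real N ^ Suc k + 1"
      by (simp only: of_nat_mult of_nat_add of_nat_power of_nat_1)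
    then have "real (Suc k) * (real N + 1) / real N ^ Suc k < (real N ^ Suc k + 1) / real N ^ Suc k"
      using N by (intro divide_strict_right_mono) auto
    moreover have "real (Suc k) * (1 / real N ^ k) * (1 + 1 / real N)
        = real (Suc k) * (real N + 1) / real N ^ Suc k"
      using N by (simp add: divide_simps)
    moreover have "(real N ^ Suc k + 1) / real N ^ Suc k = 1 - - 1 / real N ^ Suc k"
      using N by (simp add: add_divide_distrib)
    ultimately show ?thesis unfolding m(1,2) ck by simp
  next
    case False
    then have "odd k" using m by simp
    then have "c ^ k < 0" using N c by (simp add: power_less_zero_eq)
    then have "real (m - 1) * c ^ (m - 2) * (1 + 1 / real N) < 0"
      using N m by (simp add: mult_less_0_iff add_pos_pos)
    moreover have "\<bar>c\<bar> ^ Suc k \<le> 1" using assms by (intro power_le_one) auto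
    then have "c ^ (m - 1) \<le> 1" unfolding m(1) by (metis abs_le_D1 power_abs)
    ultimately show ?thesis by linarith
  qed
qed

text \<open>The strict inequality leaves room for a coefficient strictly above the Taylor coefficient
  of \<open>x ^ m\<close> at \<open>c\<close>. The coefficient is also made positive, because the sum of
  squares that it multiplies is replaced by an upper bound; this costs nothing, since the right-hand side is
  positive on its own.\<close>

lemma exists_quadratic_bound_below_slope:
  fixes N m :: nat and c :: real
  assumes "N \<ge> 2" "m \<ge> 3" "(N, m) \<noteq> (2, 4)" and c: "c = - 1 / real N"
  shows "\<exists>K. K > real (m choose 2) * c ^ (m - 2) \<and> K > 0 \<and>
    2 * K * (1 + 1 / real N) < real m * (1 - c ^ (m - 1))"
proof -
  let ?t = "real (m choose 2) * c ^ (m - 2)"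
  let ?R = "real m * (1 - c ^ (m - 1))"
  have s: "2 * (1 + 1 / real N) > 0" by (simp add: add_pos_nonneg)
  have choose: "2 * real (m choose 2) = real m * real (m - 1)"
  proof -
    have "2 * (m choose 2) = m * (m - 1)" by (simp only: choose_two) (cases m; simp)
    then show ?thesis by (metis of_nat_mult of_nat_numeral)
  qed
  have "?t * (2 * (1 + 1 / real N)) = 2 * real (m choose 2) * c ^ (m - 2) * (1 + 1 / real N)"
    by (simp only: mult_ac)
  also have "\<dots> = real m * (real (m - 1) * c ^ (m - 2) * (1 + 1 / real N))"
    by (simp only: mult.assoc[symmetric] choose)
  also have "\<dots> < ?R"
    using simplex_second_order_condition[OF assms] assms(2) by simp
  finally have "?t < ?R / (2 * (1 + 1 / real N))"
    using s by (simp only: pos_less_divide_eq)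
  moreover have "0 < ?R / (2 * (1 + 1 / real N))"
  proof -
    have "\<bar>c\<bar> < 1" using assms(1) by (simp add: c)
    then have "\<bar>c\<bar> ^ (m - 1) < 1" using assms(2) by (simp add: power_less_one_iff)
    then have "c ^ (m - 1) < 1" by (metis abs_less_iff power_abs)
    then have "0 < ?R" using assms(2) by simp
    then show ?thesis using s by (rule divide_pos_pos)
  qed
  ultimately have "max ?t 0 < ?R / (2 * (1 + 1 / real N))" by simp
  then obtain K where K: "max ?t 0 < K" "K < ?R / (2 * (1 + 1 / real N))"
    using dense by blast
  then have "K * (2 * (1 + 1 / real N)) < ?R"
    using s by (simp only: pos_less_divide_eq)
  then have "2 * K * (1 + 1 / real N) < ?R" by (simp only: mult_ac)
  then show ?thesis using K(1) by auto
qed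

section \<open>Local maximality of the frame vectors\<close>

theorem corollary1:
  fixes n m :: nat
    and w :: "'i::finite \<Rightarrow> real ^ 'd::finite"
  assumes "CARD('i) = n"
    and "n \<ge> 3" and "m \<ge> 3" and "(n, m) \<noteq> (3, 4)"
    and "regular_simplex_frame w"
  shows "\<forall>i. local_max_on (tensor_form m (simplex_tensor m w)) {v. v \<bullet> v = 1} (w i)"
proof
  fix i
  define N where "N = n - 1"
  define c where "c = - 1 / real N"
  have N: "N \<ge> 2" "n = Suc N" using assms(2) by (auto simp: N_def)
  have Nc: "real N * c = - 1" using N by (simp add: c_def)
  have unit: "w i \<bullet> w i = 1"
    using assms(5) by (simp add: regular_simplex_frame_def dot_square_norm)
  have off: "w j \<bullet> w i = c" if "j \<noteq> i" for j
    using assms(1,5) that N by (simp add: regular_simplex_frame_def c_def)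
  have cardN: "real (card (UNIV - {i})) = real N" using assms(1) N by simp

  obtain K where K: "K > real (m choose 2) * c ^ (m - 2)" "K > 0"
    "2 * K * (1 + 1 / real N) < real m * (1 - c ^ (m - 1))"
    using exists_quadratic_bound_below_slope[of N m c] N assms(3,4) c_def by auto
  \<comment> \<open>Any \<open>L\<close> above the Taylor coefficient at 1 works: it only enters at order \<open>d\<^sup>2\<close>.
      The number \<open>\<delta>\<close> is the net loss per unit of \<open>d\<close>.\<close>
  define L where "L = real (m choose 2) + 1"
  define \<delta> where "\<delta> = real m * (1 - c ^ (m - 1)) - 2 * K * (1 + 1 / real N)"

  have inner_tendsto: "((\<lambda>v. w j \<bullet> v) \<longlongrightarrow> w j \<bullet> w i) (nhds (w i))" for j
    by (intro tendsto_intros filterlim_ident)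
  have ev_i: "\<forall>\<^sub>F v in nhds (w i). (w i \<bullet> v) ^ m
      \<le> 1 + real m * (w i \<bullet> v - 1) + L * (w i \<bullet> v - 1)\<^sup>2"
    using filterlim_iff[THEN iffD1, OF inner_tendsto[of i], rule_format,
        OF eventually_power_le_quadratic[of m "w i \<bullet> w i" L]]
    by (simp add: unit L_def)
  have "\<forall>\<^sub>F v in nhds (w i). (w j \<bullet> v) ^ m
      \<le> c ^ m + real m * c ^ (m - 1) * (w j \<bullet> v - c) + K * (w j \<bullet> v - c)\<^sup>2" if "j \<noteq> i" for j
    using filterlim_iff[THEN iffD1, OF inner_tendsto[of j], rule_format,
        OF eventually_power_le_quadratic[of m "w j \<bullet> w i" K]] K(1)
    by (simp add: off that)
  then have ev_j: "\<forall>\<^sub>F v in nhds (w i). \<forall>j\<in>UNIV - {i}. (w j \<bullet> v) ^ m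
      \<le> c ^ m + real m * c ^ (m - 1) * (w j \<bullet> v - c) + K * (w j \<bullet> v - c)\<^sup>2"
    by (intro eventually_ball_finite) auto
  have "((\<lambda>v. L * (1 - w i \<bullet> v)) \<longlongrightarrow> L * (1 - w i \<bullet> w i)) (nhds (w i))"
    by (intro tendsto_intros filterlim_ident)
  then have ev_d: "\<forall>\<^sub>F v in nhds (w i). L * (1 - w i \<bullet> v) < \<delta>"
    using K(3) by (intro order_tendstoD) (auto simp: unit \<delta>_def)

  have "\<forall>\<^sub>F v in nhds (w i). v \<bullet> v = 1 \<longrightarrow>
      tensor_form m (simplex_tensor m w) v \<le> tensor_form m (simplex_tensor m w) (w i)"
    using ev_i ev_j ev_d
  proof eventually_elim
    case (elim v)
    show ?case
    proof
      assume v: "v \<bullet> v = 1"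
      define d where "d = 1 - w i \<bullet> v"
      \<comment> \<open>\<open>d\<close> is half the squared distance between \<open>w i\<close> and \<open>v\<close>.\<close>
      have "0 \<le> (w i - v) \<bullet> (w i - v)" by simp
      then have d: "d \<ge> 0" using v unit by (simp add: d_def algebra_simps inner_commute)
      have "(\<Sum>j\<in>UNIV. w j \<bullet> v) = 0"
        by (simp add: sum_regular_simplex_frame[OF assms(5)] flip: inner_sum_left)
      then have s1: "(\<Sum>j\<in>UNIV - {i}. w j \<bullet> v) = d - 1"
        by (subst (asm) sum.remove[of _ i]) (auto simp: d_def)
      have "(\<Sum>j\<in>UNIV. (w j \<bullet> v)\<^sup>2) = 1 + 1 / real N"
        using sum_inner_sq_regular_simplex_frame[OF assms(5), of v] assms(1) N v
        by (simp add: add_divide_distrib)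
      then have s2: "(\<Sum>j\<in>UNIV - {i}. (w j \<bullet> v)\<^sup>2) = 1 + 1 / real N - (1 - d)\<^sup>2"
        by (subst (asm) sum.remove[of _ i]) (auto simp: d_def)
      have dev1: "(\<Sum>j\<in>UNIV - {i}. w j \<bullet> v - c) = d"
        by (simp only: sum_subtractf s1 sum_constant cardN Nc)
      have "(\<Sum>j\<in>UNIV - {i}. (w j \<bullet> v - c)\<^sup>2)
          = (\<Sum>j\<in>UNIV - {i}. (w j \<bullet> v)\<^sup>2) + real N * c\<^sup>2 - 2 * c * (\<Sum>j\<in>UNIV - {i}. w j \<bullet> v)"
        by (simp add: power2_diff sum_subtractf sum.distrib cardN sum_distrib_left mult_ac
              del: card_Diff_insert)
      also have "\<dots> = 2 * (1 + 1 / real N) * d - d\<^sup>2"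
        using N unfolding s1 s2 by (simp add: c_def power2_eq_square field_simps)
      finally have dev2: "(\<Sum>j\<in>UNIV - {i}. (w j \<bullet> v - c)\<^sup>2) \<le> 2 * (1 + 1 / real N) * d"
        by simp
      have "(\<Sum>j\<in>UNIV - {i}. (w j \<bullet> v) ^ m)
          \<le> (\<Sum>j\<in>UNIV - {i}. c ^ m + real m * c ^ (m - 1) * (w j \<bullet> v - c) + K * (w j \<bullet> v - c)\<^sup>2)"
        using elim(2) by (intro sum_mono) auto
      also have "\<dots> = real N * c ^ m + real m * c ^ (m - 1) * d
          + K * (\<Sum>j\<in>UNIV - {i}. (w j \<bullet> v - c)\<^sup>2)"
        unfolding sum.distrib sum_distrib_left[symmetric] dev1 by (simp add: cardN del: card_Diff_insert)
      also have "\<dots> \<le> real N * c ^ m + real m * c ^ (m - 1) * d + K * (2 * (1 + 1 / real N) * d)"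
        using dev2 K(2) by (intro add_left_mono mult_left_mono) auto
      finally have others: "(\<Sum>j\<in>UNIV - {i}. (w j \<bullet> v) ^ m) \<le> \<dots>" .
      have "(\<Sum>j\<in>UNIV. (w j \<bullet> v) ^ m) = (w i \<bullet> v) ^ m + (\<Sum>j\<in>UNIV - {i}. (w j \<bullet> v) ^ m)"
        by (subst sum.remove[of _ i]) auto
      also have "\<dots> \<le> 1 + real N * c ^ m - d * (\<delta> - L * d)"
        using others elim(1) by (simp add: d_def \<delta>_def algebra_simps power2_eq_square)
      also have "\<dots> \<le> 1 + real N * c ^ m"
        using d elim(3) by (simp add: d_def)
      also have "\<dots> = (\<Sum>j\<in>UNIV. (w j \<bullet> w i) ^ m)"
        by (subst sum.remove[of _ i]) (auto simp: unit off cardN simp del: card_Diff_insert)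
      finally show "tensor_form m (simplex_tensor m w) v \<le> tensor_form m (simplex_tensor m w) (w i)"
        by (simp only: tensor_form_simplex_tensor)
    qed
  qed
  then show "local_max_on (tensor_form m (simplex_tensor m w)) {v. v \<bullet> v = 1} (w i)"
    unfolding local_max_on_def eventually_nhds_metric using unit by auto
qed

end
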